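(* Let $A\in\mathbb{R}^{n\times n}$ and $B\in\mathbb{R}^{n\times m}$, let $\Omega$ be a bounded set of parameters, and let $\Delta A(p)\in\mathbb{R}^{n\times n}$ for $p\in\Omega$. Let $Q\in\mathbb{R}^{n\times n}$ be symmetric with $Q\ge 0$, let $R_1\in\mathbb{R}^{m\times m}$ and $R_2\in\mathbb{R}^{n\times n}$ be symmetric with $R_1>0$, $R_2>0$, let $F\in\mathbb{R}^{n\times n}$ be symmetric, and let $\alpha,\beta\in\mathbb{R}$. Let $B^{+}$ denote the pseudo-inverse of $B$. Suppose there exist a scalar $\epsilon>0$ and a symmetric positive definite matrix $P\in\mathbb{R}^{n\times n}$ satisfying the Riccati equation $$A^{T}\big\{P^{-1}+BR_{1}^{-1}B^{T}+\alpha^{2}(I-BB^{+})R_{2}^{-1}(I-BB^{+})^{T}\big\}^{-1}A-P+Q+F+\beta^{2}I=0,$$ together with $$(\epsilon^{-1}I-P)^{-1}>0 \qquad\text{and}\qquad \epsilon^{-1}\Delta A(p)^{T}\Delta A(p)\le F\quad\text{for all } p\in\Omega .$$ Define the gains $$K=-R_{1}^{-1}B^{T}\big\{P^{-1}+BR_{1}^{-1}B^{T}+\alpha^{2}(I-BB^{+})R_{2}^{-1}(I-BB^{+})^{T}\big\}^{-1}A,$$ $$L=-\alpha R_{2}^{-1}(I-BB^{+})\big\{P^{-1}+BR_{1}^{-1}B^{T}+\alpha^{2}(I-BB^{+})R_{2}^{-1}(I-BB^{+})^{T}\big\}^{-1}A,$$ and put $A_c=A+BK$. If $$\big(\beta^{2}I+L^{T}R_{2}L+K^{T}R_{1}K\big)-A_{c}^{T}\big(P^{-1}-\epsilon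 I\big)^{-1}A_{c}\ge 0,$$ then the state feedback $u(k)=Kx(k)$ solves the robust control problem: for every $p\in\Omega$, the closed-loop system $$x(k+1)=(A+\Delta A(p))x(k)+BKx(k)$$ is asymptotically stable.
   Context: For symmetric matrices, $X\ge 0$ (resp. $X>0$) means positive semidefinite (resp. positive definite), and $X\le Y$ means $Y-X\ge 0$. $I$ is the identity matrix of appropriate size. The uncertain discrete-time system is $x(k+1)=(A+\Delta A(p))x(k)+Bu(k)$ with state $x(k)\in\mathbb{R}^n$, input $u(k)\in\mathbb{R}^m$, known nominal matrices $A,B$, and unknown perturbation $\Delta A(p)$ depending on an uncertain parameter vector $p$ in a bounded set $\Omega$ (no matching condition such as $\Delta A(p)=B\phi(p)$ is assumed). The robust control problem is to find a state feedback $u(k)=Kx(k)$ such that the resulting closed-loop uncertain system is asymptotically stable for all $p\in\Omega$. The matrix $L$ is the gain of an auxiliary ("virtual") input $v(k)=Lx(k)$ that is not applied to the uncertain system and enters only through the sufficient condition. *)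

theory Defs
  imports "HOL-Analysis.Analysis"
begin

definition symmetric_matrix :: "real^'n^'n \<Rightarrow> bool" where
  "symmetric_matrix X \<longleftrightarrow> transpose X = X"

definition pos_semidef :: "real^'n^'n \<Rightarrow> bool" where
  "pos_semidef X \<longleftrightarrow> symmetric_matrix X \<and> (\<forall>v. 0 \<le> v \<bullet> (X *v v))"

definition pos_def :: "real^'n^'n \<Rightarrow> bool" where
  "pos_def X \<longleftrightarrow> symmetric_matrix X \<and> (\<forall>v. v \<noteq> 0 \<longrightarrow> 0 < v \<bullet> (X *v v))"

text \<open>The Loewner order; the library's \<open>\<le>\<close> on matrices is componentwise.\<close>

definition loewner_le :: "real^'n^'n \<Rightarrow> real^'n^'n \<Rightarrow> bool" (infix "\<preceq>" 50) where
  "X \<preceq> Y \<longleftrightarrow> pos_semidef (Y - X)"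

text \<open>The Moore--Penrose pseudo-inverse, characterised by the four Penrose equations.\<close>

definition is_pinv :: "real^'m^'n \<Rightarrow> real^'n^'m \<Rightarrow> bool" where
  "is_pinv B X \<longleftrightarrow>
     B ** X ** B = B \<and> X ** B ** X = X \<and>
     symmetric_matrix (B ** X) \<and> symmetric_matrix (X ** B)"

definition pinv :: "real^'m^'n \<Rightarrow> real^'n^'m" where
  "pinv B = (THE X. is_pinv B X)"

lemma is_pinv_unique:
  assumes "is_pinv B X" "is_pinv B Y"
  shows "X = Y"
proof -
  have X: "B ** X ** B = B" "X ** B ** X = X" "transpose (B ** X) = B ** X"
      "transpose (X ** B) = X ** B"
    and Y: "B ** Y ** B = B" "Y ** B ** Y = Y" "transpose (B ** Y) = B ** Y"
      "transpose (Y ** B) = Y ** B"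
    using assms by (auto simp: is_pinv_def symmetric_matrix_def)
  have "B ** X = transpose ((B ** Y) ** (B ** X))"
    using X(3) Y(1) by (simp add: matrix_mul_assoc)
  also have "\<dots> = (B ** X) ** (B ** Y)"
    by (simp only: matrix_transpose_mul[of "B ** Y"] X(3) Y(3))
  also have "\<dots> = B ** Y"
    using X(1) by (simp add: matrix_mul_assoc)
  finally have BXY: "B ** X = B ** Y" .
  have "X ** B = transpose ((X ** B) ** (Y ** B))"
    using X(4) Y(1) by (simp add: matrix_mul_assoc[symmetric])
  also have "\<dots> = (Y ** B) ** (X ** B)"
    by (simp only: matrix_transpose_mul[of "X ** B"] X(4) Y(4))
  also have "\<dots> = Y ** B"
    using X(1) by (simp add: matrix_mul_assoc[symmetric])
  finally have XYB: "X ** B = Y ** B" .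
  have "X = Y ** (B ** X)"
    using X(2) XYB by (simp add: matrix_mul_assoc)
  then show ?thesis
    using BXY Y(2) by (simp add: matrix_mul_assoc)
qed

lemma generalized_inverse_exists:
  fixes W :: "real^'m^'n"
  shows "\<exists>X. W ** X ** W = W"
proof -
  obtain g :: "real^'n \<Rightarrow> real^'m"
    where g: "linear g" "\<And>v. v \<in> range ((*v) W) \<Longrightarrow> W *v g v = v"
    using real_vector.linear_exists_right_inverse_on[of "(*v) W" UNIV] matrix_vector_mul_linear[of W]
    unfolding linear_def by auto
  have "(W ** matrix g ** W) *v v = W *v v" for v
    using g by (simp add: matrix_vector_mul_assoc[symmetric] matrix_works linear_matrix_vector_mul_eq)
  then show ?thesis
    by (auto simp: matrix_eq)
qed

lemma transpose_mul_cancel: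
  fixes B :: "real^'m^'n" and U V :: "real^'k^'m"
  assumes "transpose B ** B ** U = transpose B ** B ** V"
  shows "B ** U = B ** V"
proof -
  have "(B ** U) *v x = (B ** V) *v x" for x
  proof -
    let ?y = "U *v x - V *v x"
    have "transpose B *v (B *v ?y) = 0"
      using arg_cong[OF assms, of "\<lambda>M. M *v x"]
      by (simp add: matrix_vector_mul_assoc[symmetric] matrix_vector_mult_diff_distrib)
    then have "?y \<bullet> (transpose B *v (B *v ?y)) = 0"
      by simp
    then have "(B *v ?y) \<bullet> (B *v ?y) = 0"
      by (metis dot_lmul_matrix inner_commute vector_transpose_matrix)
    then show ?thesis
      by (simp add: matrix_vector_mul_assoc[symmetric] matrix_vector_mult_diff_distrib)
  qed
  then show ?thesis
    by (simp add: matrix_eq)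
qed

lemma is_pinv_exists:
  fixes B :: "real^'m^'n"
  shows "\<exists>X. is_pinv B X"
proof -
  let ?T = "transpose B"
  obtain X where "(?T ** B ** ?T) ** X ** (?T ** B ** ?T) = ?T ** B ** ?T"
    using generalized_inverse_exists by blast
  then have "?T ** B ** (?T ** X ** ?T ** B ** ?T) = ?T ** B ** ?T"
    by (simp add: matrix_mul_assoc)
  then have 1: "B ** (?T ** X ** ?T ** B ** ?T) = B ** ?T"
    by (rule transpose_mul_cancel)
  define Y where "Y = ?T ** X ** ?T"
  define Z where "Z = B ** Y"
  define U where "U = Y ** B"
  have "Z ** B ** ?T = B ** ?T"
    using 1 by (simp add: Z_def Y_def matrix_mul_assoc)
  then have "transpose (Z ** B ** ?T) = transpose (B ** ?T)"
    by simp
  then have "B ** (?T ** transpose Z) = B ** ?T"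
    by (simp add: matrix_transpose_mul matrix_mul_assoc)
  then have "transpose ?T ** ?T ** transpose Z = transpose ?T ** ?T ** mat 1"
    by (simp add: matrix_mul_assoc)
  then have "?T ** transpose Z = ?T ** mat 1"
    by (rule transpose_mul_cancel)
  then have "transpose (?T ** transpose Z) = transpose ?T"
    by simp
  then have ZB: "Z ** B = B"
    by (simp add: matrix_transpose_mul)
  have Zt: "transpose Z = B ** transpose X ** B ** ?T"
    by (simp add: Z_def Y_def matrix_transpose_mul matrix_mul_assoc)
  have "Z ** transpose Z = transpose Z"
    using ZB by (simp add: Zt matrix_mul_assoc)
  then have Zs: "transpose Z = Z"
    by (metis matrix_transpose_mul transpose_transpose)
  have BU: "B ** U = B"
    using ZB by (simp add: Z_def U_def matrix_mul_assoc)
  have Ut: "transpose U = ?T ** B ** transpose X ** B"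
    by (simp add: U_def Y_def matrix_transpose_mul matrix_mul_assoc)
  have "transpose U ** U = transpose U"
    using BU by (simp add: Ut matrix_mul_assoc[symmetric])
  then have Us: "transpose U = U"
    by (metis matrix_transpose_mul transpose_transpose)
  have "U ** ?T = ?T"
    using BU Us by (metis matrix_transpose_mul)
  then have "U ** Y = Y"
    by (simp add: Y_def matrix_mul_assoc)
  then have "is_pinv B Y"
    using ZB Zs Us by (simp add: is_pinv_def symmetric_matrix_def Z_def U_def)
  then show ?thesis ..
qed

lemma is_pinv_pinv: "is_pinv B (pinv B)"
  unfolding pinv_def using is_pinv_exists is_pinv_unique by (metis theI)

text \<open>Asymptotic stability of the origin for \<open>x(k+1) = f(x(k))\<close>: Lyapunov stability together
  with attractivity. Convergence is required of every trajectory, not only of those starting near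
  the origin; for linear \<open>f\<close> the two readings coincide.\<close>

definition trajectory :: "('a \<Rightarrow> 'a) \<Rightarrow> (nat \<Rightarrow> 'a) \<Rightarrow> bool" where
  "trajectory f x \<longleftrightarrow> (\<forall>k. x (Suc k) = f (x k))"

definition lyapunov_stable :: "('a::real_normed_vector \<Rightarrow> 'a) \<Rightarrow> bool" where
  "lyapunov_stable f \<longleftrightarrow>
     (\<forall>e>0. \<exists>d>0. \<forall>x. trajectory f x \<and> norm (x 0) < d \<longrightarrow> (\<forall>k. norm (x k) < e))"

definition asymptotically_stable :: "('a::real_normed_vector \<Rightarrow> 'a) \<Rightarrow> bool" where
  "asymptotically_stable f \<longleftrightarrow>
     lyapunov_stable f \<and> (\<forall>x. trajectory f x \<longrightarrow> x \<longlonglongrightarrow> 0)"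

definition solves_robust_control_problem ::
  "real^'n^'n \<Rightarrow> ('p \<Rightarrow> real^'n^'n) \<Rightarrow> real^'m^'n \<Rightarrow> 'p set \<Rightarrow> real^'n^'m \<Rightarrow> bool" where
  "solves_robust_control_problem A dA B \<Omega> K \<longleftrightarrow>
     (\<forall>p\<in>\<Omega>. asymptotically_stable (\<lambda>x. (A + dA p) *v x + B *v (K *v x)))"

end

theory Submission
  imports Defs
begin

text \<open>The function \<open>V x = x \<bullet> (P *v x)\<close> is a common Lyapunov function. Young's inequality
  \<open>2 (t \<bullet> y) - t \<bullet> (X *v t) \<le> y \<bullet> (X\<^sup>-\<^sup>1 *v y)\<close> bounds \<open>V\<close> after one step by the nominal
  closed-loop term with weight \<open>(P\<^sup>-\<^sup>1 - \<epsilon> I)\<^sup>-\<^sup>1\<close> plus \<open>\<epsilon>\<^sup>-\<^sup>1 |\<Delta>A x|\<^sup>2\<close>. With \<open>w = M\<^sup>-\<^sup>1 A x\<close> the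
  terms in \<open>K\<close> and \<open>L\<close> are exactly the last two summands of \<open>w \<bullet> (M *v w)\<close>, so that the Riccati
  equation makes \<open>V\<close> decrease by at least \<open>w \<bullet> (P\<^sup>-\<^sup>1 *v w) + x \<bullet> (Q *v x)\<close>. This can vanish for
  \<open>x \<noteq> 0\<close> only if \<open>A x = 0\<close>; there the next state is \<open>\<Delta>A x\<close>, and the strict inequality
  \<open>P < \<epsilon>\<^sup>-\<^sup>1 I\<close> still gives a strict decrease.\<close>

section \<open>Quadratic forms and inverses of positive definite matrices\<close>

lemma inner_matrix_transpose:
  fixes A :: "real^'n^'m"
  shows "x \<bullet> (A *v y) = (transpose A *v x) \<bullet> y"
  by (simp add: dot_lmul_matrix[symmetric])

lemma scaleR_matrix_vector: "(c *\<^sub>R (A::real^'n^'m)) *v x = c *\<^sub>R (A *v x)"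
  by (simp add: scaleR_matrix_vector_assoc)

lemma uminus_matrix_vector: "(- (A::real^'n^'m)) *v x = - (A *v x)"
  using matrix_vector_mult_diff_rdistrib[of 0 A x] by simp

lemma quadratic_form_congruence:
  fixes T :: "real^'n^'m" and X :: "real^'m^'m"
  shows "x \<bullet> ((transpose T ** X ** T) *v x) = (T *v x) \<bullet> (X *v (T *v x))"
  by (simp add: inner_matrix_transpose[of x "transpose T"] matrix_vector_mul_assoc[symmetric]
      del: transpose_matrix_vector)

lemma symmetric_matrix_inner:
  assumes "symmetric_matrix X"
  shows "x \<bullet> (X *v y) = y \<bullet> (X *v x)"
  using assms by (metis inner_commute inner_matrix_transpose symmetric_matrix_def)

lemma pos_def_nonneg:
  assumes "pos_def X"
  shows "0 \<le> v \<bullet> (X *v v)"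
  using assms unfolding pos_def_def by (cases "v = 0") (auto intro: less_imp_le)

text \<open>A kernel vector would make the form vanish. Asking only for positivity of the form lets
  this apply to \<open>M\<close> once its form is bounded below by that of
  \<open>matrix_inv P\<close>.\<close>

lemma invertible_of_positive:
  fixes X :: "real^'n^'n"
  assumes "\<And>v. v \<noteq> 0 \<Longrightarrow> 0 < v \<bullet> (X *v v)"
  shows "invertible X"
proof -
  have "\<forall>v. X *v v = 0 \<longrightarrow> v = 0"
    using assms by (metis inner_zero_right less_irrefl)
  then show ?thesis
    using invertible_left_inverse matrix_left_invertible_ker by blast
qed

lemma pos_def_invertible: "pos_def X \<Longrightarrow> invertible X"
  by (rule invertible_of_positive) (simp add: pos_def_def)

lemma
  fixes X :: "real^'n^'n"
  assumes "invertible X"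
  shows matrix_inv_right: "X ** matrix_inv X = mat 1"
    and matrix_inv_left: "matrix_inv X ** X = mat 1"
proof -
  have "X ** matrix_inv X = mat 1 \<and> matrix_inv X ** X = mat 1"
    unfolding matrix_inv_def by (rule someI_ex) (use assms in \<open>simp add: invertible_def\<close>)
  then show "X ** matrix_inv X = mat 1" "matrix_inv X ** X = mat 1"
    by auto
qed

lemma matrix_inv_mul_cancel:
  fixes X :: "real^'n^'n"
  assumes "invertible X"
  shows "X *v (matrix_inv X *v v) = v" "matrix_inv X *v (X *v v) = v"
  using assms
  by (simp_all add: matrix_vector_mul_assoc matrix_inv_left matrix_inv_right)

lemma pos_def_matrix_inv:
  assumes "pos_def X"
  shows "pos_def (matrix_inv X)"
proof -
  note inv = pos_def_invertible[OF assms]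
  have sym: "symmetric_matrix X"
    using assms by (simp add: pos_def_def)
  have "transpose (matrix_inv X) ** X = mat 1"
    using sym matrix_inv_right[OF inv]
    by (metis matrix_transpose_mul symmetric_matrix_def transpose_mat)
  then have "transpose (matrix_inv X) = matrix_inv X"
    by (metis inv matrix_inv_right matrix_mul_assoc matrix_mul_lid matrix_mul_rid)
  moreover have "0 < v \<bullet> (matrix_inv X *v v)" if "v \<noteq> 0" for v
  proof -
    have "matrix_inv X *v v \<noteq> 0"
      using that matrix_inv_mul_cancel(1)[OF inv, of v] by auto
    then show ?thesis
      using assms matrix_inv_mul_cancel(1)[OF inv, of v]
      by (metis inner_commute pos_def_def)
  qed
  ultimately show ?thesis
    by (simp add: pos_def_def symmetric_matrix_def)
qed

lemma matrix_inv_matrix_inv: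
  fixes X :: "real^'n^'n"
  assumes "invertible X"
  shows "matrix_inv (matrix_inv X) = X"
proof -
  have "invertible (matrix_inv X)"
    using assms matrix_inv_left matrix_inv_right invertible_def by blast
  then show ?thesis
    by (metis assms matrix_inv_left matrix_mul_assoc matrix_mul_lid matrix_mul_rid)
qed

section \<open>Young's inequality and the bound for a perturbed step\<close>

lemma young_inequality_pos_def:
  assumes "pos_def X"
  shows "2 * (t \<bullet> y) - t \<bullet> (X *v t) \<le> y \<bullet> (matrix_inv X *v y)"
proof -
  \<comment> \<open>As a function of \<open>t\<close> the left side is concave with maximiser
    \<open>u\<close>; the inequality is the completed square around it.\<close>
  define u where "u = matrix_inv X *v y"
  have y: "y = X *v u"
    using assms by (simp add: u_def matrix_inv_mul_cancel pos_def_invertible)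
  have "t \<bullet> (X *v u) = u \<bullet> (X *v t)"
    using assms by (intro symmetric_matrix_inner) (simp add: pos_def_def)
  moreover have "0 \<le> (t - u) \<bullet> (X *v (t - u))"
    using assms by (rule pos_def_nonneg)
  moreover have "y \<bullet> (matrix_inv X *v y) = u \<bullet> (X *v u)"
    by (metis u_def y inner_commute)
  ultimately show ?thesis
    by (simp add: y matrix_vector_mult_diff_distrib inner_diff_left inner_diff_right)
qed

text \<open>Passes from P < I/\<epsilon> to the inverses without eigenvalues: Young's inequality
  with \<open>t = \<epsilon> *\<^sub>R v\<close> bounds the form of \<open>matrix_inv P\<close>
  below by \<open>2 * \<epsilon> * (v \<bullet> v) - \<epsilon>\<^sup>2 * (v \<bullet> (P *v
  v))\<close>, which exceeds \<open>\<epsilon> * (v \<bullet> v)\<close>.\<close>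

lemma pos_def_inv_diff_scaled_id:
  fixes P :: "real^'n^'n"
  assumes P: "pos_def P" and "\<epsilon> > 0"
    and PI: "\<And>v. v \<noteq> 0 \<Longrightarrow> \<epsilon> * (v \<bullet> (P *v v)) < v \<bullet> v"
  shows "pos_def (matrix_inv P - \<epsilon> *\<^sub>R mat 1)"
proof -
  have "transpose (matrix_inv P - \<epsilon> *\<^sub>R mat 1) = matrix_inv P - \<epsilon> *\<^sub>R mat 1"
    using pos_def_matrix_inv[OF P]
    by (simp add: pos_def_def symmetric_matrix_def transpose_def mat_def vec_eq_iff)
  moreover have "0 < v \<bullet> ((matrix_inv P - \<epsilon> *\<^sub>R mat 1) *v v)" if "v \<noteq> 0" for v
  proof -
    have "\<epsilon> * (\<epsilon> * (v \<bullet> (P *v v))) < \<epsilon> * (v \<bullet> v)"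
      using PI[OF that] \<open>\<epsilon> > 0\<close> by simp
    then show ?thesis
      using young_inequality_pos_def[OF P, of "\<epsilon> *\<^sub>R v" v]
      by (simp add: matrix_vector_mult_diff_rdistrib scaleR_matrix_vector inner_diff_right
          matrix_vector_mult_scaleR)
  qed
  ultimately show ?thesis
    by (simp add: pos_def_def symmetric_matrix_def)
qed

text \<open>With \<open>y = P *v (a + d)\<close> the left side equals
  \<open>2 * ((a + d) \<bullet> y) - y \<bullet> (matrix_inv P *v y)\<close>. Adding and subtracting
  \<open>\<epsilon> * (y \<bullet> y)\<close> separates \<open>a\<close> from \<open>d\<close>:
  Young's inequality bounds the first part, a square the second.\<close>

lemma perturbed_quadratic_form_bound:
  fixes P :: "real^'n^'n"
  assumes P: "pos_def P" and "\<epsilon> > 0" and S: "pos_def (matrix_inv P - \<epsilon> *\<^sub>R mat 1)"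
  shows "(a + d) \<bullet> (P *v (a + d))
    \<le> a \<bullet> (matrix_inv (matrix_inv P - \<epsilon> *\<^sub>R mat 1) *v a) + inverse \<epsilon> * (d \<bullet> d)"
proof -
  define y where "y = P *v (a + d)"
  have *: "(a + d) \<bullet> y = y \<bullet> (matrix_inv P *v y)"
    by (simp add: y_def matrix_inv_mul_cancel pos_def_invertible[OF P] inner_commute)
  have "0 \<le> inverse \<epsilon> * ((d - \<epsilon> *\<^sub>R y) \<bullet> (d - \<epsilon> *\<^sub>R y))"
    using \<open>\<epsilon> > 0\<close> by simp
  also have "\<dots> = inverse \<epsilon> * (d \<bullet> d) - 2 * (d \<bullet> y) + \<epsilon> * (y \<bullet> y)"
    using \<open>\<epsilon> > 0\<close> by (simp add: inner_diff_left inner_diff_right inner_commute field_simps)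
  finally have "2 * (d \<bullet> y) - \<epsilon> * (y \<bullet> y) \<le> inverse \<epsilon> * (d \<bullet> d)"
    by simp
  moreover have "2 * (a \<bullet> y) - y \<bullet> (matrix_inv P *v y) + \<epsilon> * (y \<bullet> y)
      \<le> a \<bullet> (matrix_inv (matrix_inv P - \<epsilon> *\<^sub>R mat 1) *v a)"
    using young_inequality_pos_def[OF S, of y a]
    by (simp add: matrix_vector_mult_diff_rdistrib scaleR_matrix_vector inner_diff_right
        inner_commute)
  ultimately show ?thesis
    using * by (simp add: y_def[symmetric] inner_add_left)
qed

section \<open>Lyapunov's theorem for linear maps and quadratic functions\<close>

lemma asymptotically_stable_of_quadratic_decrease:
  fixes P :: "real^'n^'n"
  assumes P: "pos_def P" and f: "linear f"
    and dec: "\<And>x. x \<noteq> 0 \<Longrightarrow> f x \<bullet> (P *v f x) < x \<bullet> (P *v x)"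
  shows "asymptotically_stable f"
proof -
  define V where "V x = x \<bullet> (P *v x)" for x
  let ?S = "sphere (0::real^'n) 1"
  have V_pos: "V x > 0" if "x \<noteq> 0" for x
    using P that by (simp add: V_def pos_def_def)
  have V_scale: "V (c *\<^sub>R x) = c\<^sup>2 * V x" for c x
    by (simp add: V_def matrix_vector_mult_scaleR power2_eq_square)
  have f_scale: "f (c *\<^sub>R x) = c *\<^sub>R f x" for c x
    using f by (simp add: linear_scale)
  have S: "compact ?S" "?S \<noteq> {}"
    by (auto intro!: exI[of _ "axis undefined (1::real)"])
  have nz: "x \<noteq> 0" if "x \<in> ?S" for x
    using that by auto
  have cP: "continuous_on ?S g \<Longrightarrow> continuous_on ?S (\<lambda>x. V (g x))" for g
    unfolding V_def by (intro continuous_intros matrix_vector_mult_linear_continuous_on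
        continuous_on_compose2[OF matrix_vector_mult_linear_continuous_on[of UNIV]]) auto
  have cf: "continuous_on ?S f"
    using f by (simp add: linear_continuous_on linear_conv_bounded_linear)
  have cV: "continuous_on ?S V"
    using cP[of "\<lambda>x. x"] by simp
  \<comment> \<open>The pointwise strict decrease becomes uniform: by homogeneity
    \<open>V (f x) / V x\<close> depends only on the direction of \<open>x\<close>, so its maximum
    \<open>c\<close> over the compact unit sphere is a contraction factor, and
    \<open>c < 1\<close>.\<close>
  have "continuous_on ?S (\<lambda>x. V (f x) / V x)"
    using V_pos nz by (intro continuous_on_divide cP cf cV) force
  then obtain s where s: "s \<in> ?S" "\<And>x. x \<in> ?S \<Longrightarrow> V (f x) / V x \<le> V (f s) / V s"
    using continuous_attains_sup[OF S] by blast
  define c where "c = V (f s) / V s"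
  obtain l where l: "l \<in> ?S" "\<And>x. x \<in> ?S \<Longrightarrow> V l \<le> V x"
    using continuous_attains_inf[OF S cV] by blast
  obtain u where u: "u \<in> ?S" "\<And>x. x \<in> ?S \<Longrightarrow> V x \<le> V u"
    using continuous_attains_sup[OF S cV] by blast
  have "V (f s) \<ge> 0"
    unfolding V_def by (rule pos_def_nonneg[OF P])
  then have c: "0 \<le> c" "c < 1"
    using dec[OF nz[OF s(1)]] V_pos[OF nz[OF s(1)]] by (auto simp: c_def V_def)
  have Vl: "V l > 0" and Vu: "V u > 0"
    using l u nz V_pos by auto
  have unit: "\<exists>e\<in>?S. x = norm x *\<^sub>R e" if "x \<noteq> 0" for x :: "real^'n"
    using that by (intro bexI[of _ "inverse (norm x) *\<^sub>R x"]) auto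
  have contr: "V (f x) \<le> c * V x" and lower: "V l * (norm x)\<^sup>2 \<le> V x"
    and upper: "V x \<le> V u * (norm x)\<^sup>2" for x
  proof -
    have "V (f x) \<le> c * V x \<and> V l * (norm x)\<^sup>2 \<le> V x \<and> V x \<le> V u * (norm x)\<^sup>2"
    proof (cases "x = 0")
      case True
      then show ?thesis
        using f by (simp add: V_def linear_0)
    next
      case False
      then obtain e where e: "e \<in> ?S" "x = norm x *\<^sub>R e"
        using unit by blast
      have "V (f e) \<le> c * V e"
        using s(2)[OF e(1)] V_pos[OF nz[OF e(1)]] by (simp add: c_def[symmetric] field_simps)
      then have "(norm x)\<^sup>2 * V (f e) \<le> (norm x)\<^sup>2 * (c * V e)"
        by (rule mult_left_mono) simp
      moreover have "(norm x)\<^sup>2 * V l \<le> (norm x)\<^sup>2 * V e" "(norm x)\<^sup>2 * V e \<le> (norm x)\<^sup>2 * V u"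
        using l(2) u(2) e(1) by (auto intro: mult_left_mono)
      moreover have "V x = (norm x)\<^sup>2 * V e" "V (f x) = (norm x)\<^sup>2 * V (f e)"
        using e(2) V_scale f_scale by metis+
      ultimately show ?thesis
        by (simp add: algebra_simps)
    qed
    then show "V (f x) \<le> c * V x" "V l * (norm x)\<^sup>2 \<le> V x" "V x \<le> V u * (norm x)\<^sup>2"
      by auto
  qed
  \<comment> \<open>The cost of passing from the geometric decay of \<open>V\<close> to that of the
    squared norm, by the two-sided bound on \<open>V\<close>.\<close>
  define C where "C = V u / V l"
  have C: "C > 0"
    using Vl Vu by (simp add: C_def)
  have bound: "(norm (x k))\<^sup>2 \<le> C * c ^ k * (norm (x 0))\<^sup>2" if "trajectory f x" for x k
  proof -
    have "V (x k) \<le> c ^ k * V (x 0)"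
    proof (induction k)
      case (Suc k)
      have "V (x (Suc k)) \<le> c * V (x k)"
        using that contr by (simp add: trajectory_def)
      also have "\<dots> \<le> c * (c ^ k * V (x 0))"
        using Suc c by (intro mult_left_mono) auto
      finally show ?case
        by simp
    qed simp
    also have "\<dots> \<le> c ^ k * (V u * (norm (x 0))\<^sup>2)"
      using upper c by (intro mult_left_mono) auto
    finally have "V l * (norm (x k))\<^sup>2 \<le> c ^ k * (V u * (norm (x 0))\<^sup>2)"
      using lower[of "x k"] by linarith
    then show ?thesis
      using Vl by (simp add: C_def field_simps)
  qed
  have "lyapunov_stable f"
    unfolding lyapunov_stable_def
  proof (intro allI impI)
    fix e :: real assume "e > 0"
    \<comment> \<open>The radius is chosen so that
      \<open>C * (e / sqrt C)\<^sup>2 = e\<^sup>2\<close>.\<close>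
    have "norm (x k) < e" if x: "trajectory f x" "norm (x 0) < e / sqrt C" for x k
    proof -
      have "(norm (x k))\<^sup>2 \<le> C * c ^ k * (norm (x 0))\<^sup>2"
        using bound x by blast
      also have "\<dots> \<le> C * (norm (x 0))\<^sup>2"
        using C c by (intro mult_right_mono) (auto simp: power_le_one)
      also have "\<dots> < C * (e / sqrt C)\<^sup>2"
        using C x(2) by (intro mult_strict_left_mono power_strict_mono) auto
      also have "\<dots> = e\<^sup>2"
        using C by (simp add: power_divide)
      finally show ?thesis
        using \<open>e > 0\<close> by (simp add: power2_less_imp_less)
    qed
    then show "\<exists>d>0. \<forall>x. trajectory f x \<and> norm (x 0) < d \<longrightarrow> (\<forall>k. norm (x k) < e)"
      using \<open>e > 0\<close> C by (intro exI[of _ "e / sqrt C"]) auto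
  qed
  moreover have "x \<longlonglongrightarrow> 0" if "trajectory f x" for x
  proof -
    have "(\<lambda>k. C * c ^ k * (norm (x 0))\<^sup>2) \<longlonglongrightarrow> C * 0 * (norm (x 0))\<^sup>2"
      using c by (intro tendsto_intros LIMSEQ_power_zero) auto
    then have "(\<lambda>k. C * c ^ k * (norm (x 0))\<^sup>2) \<longlonglongrightarrow> 0"
      by simp
    then have "(\<lambda>k. (norm (x k))\<^sup>2) \<longlonglongrightarrow> 0"
      by (rule Lim_null_comparison[rotated]) (simp add: bound[OF that])
    then have "(\<lambda>k. sqrt ((norm (x k))\<^sup>2)) \<longlonglongrightarrow> sqrt 0"
      by (rule tendsto_real_sqrt)
    then show ?thesis
      by (simp add: tendsto_norm_zero_iff)
  qed
  ultimately show ?thesis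
    by (simp add: asymptotically_stable_def)
qed

section \<open>Decrease of the Lyapunov function along the uncertain closed loop\<close>

theorem theorem1:
  fixes A Q F P M R\<^sub>2 L A\<^sub>c :: "real^'n^'n"
    and B :: "real^'m^'n"
    and R\<^sub>1 :: "real^'m^'m"
    and K :: "real^'n^'m"
    and dA :: "'p::euclidean_space \<Rightarrow> real^'n^'n"
    and \<Omega> :: "'p set"
    and \<alpha> \<beta> \<epsilon> :: real
  assumes "bounded \<Omega>"
    and "pos_semidef Q" and "pos_def R\<^sub>1" and "pos_def R\<^sub>2" and "symmetric_matrix F"
    and "\<epsilon> > 0" and "pos_def P"
    and M: "M = matrix_inv P + B ** matrix_inv R\<^sub>1 ** transpose B
              + \<alpha>\<^sup>2 *\<^sub>R ((mat 1 - B ** pinv B) ** matrix_inv R\<^sub>2 ** transpose (mat 1 - B ** pinv B))"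
    and riccati: "transpose A ** matrix_inv M ** A - P + Q + F + \<beta>\<^sup>2 *\<^sub>R mat 1 = 0"
    and "invertible (inverse \<epsilon> *\<^sub>R mat 1 - P)"
    and "pos_def (matrix_inv (inverse \<epsilon> *\<^sub>R mat 1 - P))"
    and "\<forall>p\<in>\<Omega>. inverse \<epsilon> *\<^sub>R (transpose (dA p) ** dA p) \<preceq> F"
    and K: "K = - (matrix_inv R\<^sub>1 ** transpose B ** matrix_inv M ** A)"
    and L: "L = - (\<alpha> *\<^sub>R (matrix_inv R\<^sub>2 ** (mat 1 - B ** pinv B) ** matrix_inv M ** A))"
    and A\<^sub>c: "A\<^sub>c = A + B ** K"
    and "pos_semidef (\<beta>\<^sup>2 *\<^sub>R mat 1 + transpose L ** R\<^sub>2 ** L + transpose K ** R\<^sub>1 ** K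
           - transpose A\<^sub>c ** matrix_inv (matrix_inv P - \<epsilon> *\<^sub>R mat 1) ** A\<^sub>c)"
  shows "solves_robust_control_problem A dA B \<Omega> K"
  unfolding solves_robust_control_problem_def
proof (rule ballI)
  fix p assume "p \<in> \<Omega>"
  note P = \<open>pos_def P\<close> and eps = \<open>\<epsilon> > 0\<close>
  have iP: "pos_def (matrix_inv P)" and iR\<^sub>1: "pos_def (matrix_inv R\<^sub>1)"
    and iR\<^sub>2: "pos_def (matrix_inv R\<^sub>2)"
    using assms by (simp_all add: pos_def_matrix_inv)
  have PI: "\<epsilon> * (v \<bullet> (P *v v)) < v \<bullet> v" if "v \<noteq> 0" for v
  proof -
    \<comment> \<open>Positivity is given for the inverse and is inverted back. This rests on
      invertibility, since \<open>matrix_inv\<close> of a singular matrix is an unspecified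
      value.\<close>
    have "pos_def (inverse \<epsilon> *\<^sub>R mat 1 - P)"
      using pos_def_matrix_inv[OF \<open>pos_def (matrix_inv (inverse \<epsilon> *\<^sub>R mat 1 - P))\<close>]
      by (simp add: matrix_inv_matrix_inv \<open>invertible (inverse \<epsilon> *\<^sub>R mat 1 - P)\<close>)
    then have "v \<bullet> (P *v v) < inverse \<epsilon> * (v \<bullet> v)"
      using that by (simp add: pos_def_def matrix_vector_mult_diff_rdistrib scaleR_matrix_vector
          inner_diff_right)
    then show ?thesis
      using eps by (simp add: field_simps)
  qed
  have S: "pos_def (matrix_inv P - \<epsilon> *\<^sub>R mat 1)"
    by (rule pos_def_inv_diff_scaled_id[OF P eps PI])
  define N where "N = mat 1 - B ** pinv B"
  \<comment> \<open>A Penrose equation makes \<open>B ** pinv B\<close> symmetric. Hence the last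
    summand of \<open>M\<close> is a form in \<open>N *v w\<close>, the same vector that occurs in
    \<open>L *v x\<close>.\<close>
  have N: "transpose N = N"
    using is_pinv_pinv[of B]
    by (simp add: N_def is_pinv_def symmetric_matrix_def transpose_def mat_def vec_eq_iff)
  have M_form: "w \<bullet> (M *v w) = w \<bullet> (matrix_inv P *v w)
      + (transpose B *v w) \<bullet> (matrix_inv R\<^sub>1 *v (transpose B *v w))
      + \<alpha>\<^sup>2 * ((N *v w) \<bullet> (matrix_inv R\<^sub>2 *v (N *v w)))" for w
    using quadratic_form_congruence[of w "transpose B" "matrix_inv R\<^sub>1"]
      quadratic_form_congruence[of w N "matrix_inv R\<^sub>2"]
    by (simp add: M N_def[symmetric] N matrix_vector_mult_add_rdistrib scaleR_matrix_vector
        inner_add_right)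
  have M_ge: "w \<bullet> (matrix_inv P *v w) \<le> w \<bullet> (M *v w)" for w
    unfolding M_form using pos_def_nonneg[OF iR\<^sub>1] pos_def_nonneg[OF iR\<^sub>2] by simp
  have iM: "invertible M"
    using iP M_ge by (intro invertible_of_positive) (meson less_le_trans pos_def_def)
  let ?f = "\<lambda>x. (A + dA p) *v x + B *v (K *v x)"
  have f_eq: "?f x = A\<^sub>c *v x + dA p *v x" for x
    by (simp add: A\<^sub>c matrix_vector_mult_add_rdistrib matrix_vector_mul_assoc)
  show "asymptotically_stable ?f"
  proof (rule asymptotically_stable_of_quadratic_decrease[OF P])
    show "linear ?f"
      unfolding f_eq by (intro linear_compose_add matrix_vector_mul_linear)
    fix x :: "real^'n" assume "x \<noteq> 0"
    define w where "w = matrix_inv M *v (A *v x)"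
    let ?r = "(transpose B *v w) \<bullet> (matrix_inv R\<^sub>1 *v (transpose B *v w))"
    let ?s = "\<alpha>\<^sup>2 * ((N *v w) \<bullet> (matrix_inv R\<^sub>2 *v (N *v w)))"
    have Mw: "M *v w = A *v x"
      by (simp add: w_def matrix_inv_mul_cancel iM)
    have Kx: "K *v x = - (matrix_inv R\<^sub>1 *v (transpose B *v w))"
      by (simp add: K w_def uminus_matrix_vector matrix_vector_mul_assoc matrix_mul_assoc
          del: transpose_matrix_vector)
    have Lx: "L *v x = - (\<alpha> *\<^sub>R (matrix_inv R\<^sub>2 *v (N *v w)))"
      by (simp add: L N_def[symmetric] w_def uminus_matrix_vector scaleR_matrix_vector
          matrix_vector_mul_assoc matrix_mul_assoc)
    have K_form: "(K *v x) \<bullet> (R\<^sub>1 *v (K *v x)) = ?r"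
      using \<open>pos_def R\<^sub>1\<close>
      by (simp add: Kx vec.neg matrix_inv_mul_cancel pos_def_invertible inner_commute)
    have L_form: "(L *v x) \<bullet> (R\<^sub>2 *v (L *v x)) = ?s"
      using \<open>pos_def R\<^sub>2\<close>
      by (simp add: Lx vec.neg matrix_vector_mult_scaleR matrix_inv_mul_cancel pos_def_invertible
          inner_commute power2_eq_square)
    \<comment> \<open>Since \<open>A *v x = M *v w\<close>, the first Riccati term at
      \<open>x\<close> becomes \<open>w \<bullet> (M *v w)\<close>.\<close>
    have "x \<bullet> ((transpose A ** matrix_inv M ** A - P + Q + F + \<beta>\<^sup>2 *\<^sub>R mat 1) *v x) = 0"
      by (simp add: riccati)
    then have ric: "w \<bullet> (M *v w) - x \<bullet> (P *v x) + x \<bullet> (Q *v x) + x \<bullet> (F *v x) + \<beta>\<^sup>2 * (x \<bullet> x) = 0"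
      by (simp add: matrix_vector_mult_add_rdistrib matrix_vector_mult_diff_rdistrib
          scaleR_matrix_vector inner_add_right inner_diff_right quadratic_form_congruence
          w_def[symmetric] Mw inner_commute)
    have Q: "0 \<le> x \<bullet> (Q *v x)"
      using \<open>pos_semidef Q\<close> by (simp add: pos_semidef_def)
    have "pos_semidef (F - inverse \<epsilon> *\<^sub>R (transpose (dA p) ** dA p))"
      using assms \<open>p \<in> \<Omega>\<close> by (simp add: loewner_le_def)
    then have "0 \<le> x \<bullet> ((F - inverse \<epsilon> *\<^sub>R (transpose (dA p) ** dA p)) *v x)"
      by (simp add: pos_semidef_def)
    then have F: "inverse \<epsilon> * ((dA p *v x) \<bullet> (dA p *v x)) \<le> x \<bullet> (F *v x)"
      using quadratic_form_congruence[of x "dA p" "mat 1"]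
      by (simp add: matrix_vector_mult_diff_rdistrib scaleR_matrix_vector inner_diff_right)
    show "?f x \<bullet> (P *v ?f x) < x \<bullet> (P *v x)"
    proof (cases "A *v x = 0")
      case True
      then have "w = 0"
        by (simp add: w_def)
      then have next_state: "?f x = dA p *v x"
        using True Kx by (simp add: matrix_vector_mult_add_rdistrib)
      show ?thesis
      \<comment> \<open>The inequality \<open>PI\<close> is strict only at nonzero vectors; a zero
        next state is settled by positivity of \<open>P\<close>.\<close>
      proof (cases "dA p *v x = 0")
        case True
        then show ?thesis
          using P \<open>x \<noteq> 0\<close> by (simp add: next_state pos_def_def)
      next
        case False
        have "(dA p *v x) \<bullet> (P *v (dA p *v x)) < inverse \<epsilon> * ((dA p *v x) \<bullet> (dA p *v x))"
          using PI[OF False] eps by (simp add: field_simps)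
        \<comment> \<open>With \<open>w = 0\<close> the Riccati equation expresses
          \<open>x \<bullet> (P *v x)\<close> as the sum of the forms of \<open>Q\<close>,
          \<open>F\<close> and \<open>\<beta>\<^sup>2 *\<^sub>R mat 1\<close>, hence it is at least
          \<open>x \<bullet> (F *v x)\<close>.\<close>
        also have "\<dots> \<le> x \<bullet> (P *v x)"
        proof -
          have "0 \<le> \<beta>\<^sup>2 * (x \<bullet> x)" "w \<bullet> (M *v w) = 0"
            using \<open>w = 0\<close> by simp_all
          then show ?thesis
            using F Q ric by linarith
        qed
        finally show ?thesis
          by (simp add: next_state)
      qed
    next
      case False
      then have "w \<noteq> 0"
        using Mw by auto
      then have w: "0 < w \<bullet> (matrix_inv P *v w)"
        using iP by (simp add: pos_def_def)
      let ?c = "(A\<^sub>c *v x) \<bullet> (matrix_inv (matrix_inv P - \<epsilon> *\<^sub>R mat 1) *v (A\<^sub>c *v x))"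
      have "0 \<le> x \<bullet> ((\<beta>\<^sup>2 *\<^sub>R mat 1 + transpose L ** R\<^sub>2 ** L + transpose K ** R\<^sub>1 ** K
           - transpose A\<^sub>c ** matrix_inv (matrix_inv P - \<epsilon> *\<^sub>R mat 1) ** A\<^sub>c) *v x)"
        using assms by (simp add: pos_semidef_def)
      then have "?c \<le> \<beta>\<^sup>2 * (x \<bullet> x) + ?s + ?r"
        unfolding K_form[symmetric] L_form[symmetric]
        by (simp add: matrix_vector_mult_add_rdistrib matrix_vector_mult_diff_rdistrib
            scaleR_matrix_vector inner_add_right inner_diff_right quadratic_form_congruence)
      moreover have "?f x \<bullet> (P *v ?f x) \<le> ?c + inverse \<epsilon> * ((dA p *v x) \<bullet> (dA p *v x))"
        unfolding f_eq by (rule perturbed_quadratic_form_bound[OF P eps S])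
      \<comment> \<open>The new value is at most \<open>\<beta>\<^sup>2 * (x \<bullet> x) + ?s + ?r
        + x \<bullet> (F *v x)\<close>, which by \<open>ric\<close> and \<open>M_form\<close> is
        \<open>x \<bullet> (P *v x) - w \<bullet> (matrix_inv P *v w) - x \<bullet> (Q *v
        x)\<close>; the middle term gives strictness.\<close>
      ultimately show ?thesis
        using ric w Q F M_form[of w] by linarith
    qed
  qed
qed

end
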